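(* Let $\mathbf{x}\in L^2(\mathbb{R})$, $k\in\mathbb{Q}^+$ and $\theta\in\mathbb{R}$ with $\theta\notin\pi\mathbb{Z}$. Then, with window function $\mathbf{h}=\mathbf{x}$, for $\tau,u\in\mathbb{R}$, $$\mathcal{A}^{\theta,k}_{\mathbf{x}}\left(\frac{\tau}{k},\,u\sin\theta+\tau\cos\theta\right)=|\Omega_\theta|^2\,e^{iu\frac{\tau}{2}}\,\mathcal{V}_{\mathbf{h}}[\mathbf{x}](\tau,u).$$
   Context: Superscript $*$ denotes complex conjugation. $\Omega_\theta=\sqrt{(1-i\cot\theta)/2\pi}$, so $|\Omega_\theta|^2=|\csc\theta|/(2\pi)$. The new fractional ambiguity function (NFrAF) of $\mathbf{x}\in L^2(\mathbb{R})$ with parameters $(\theta,k)$ is $$\mathcal{A}^{\theta,k}_{\mathbf{x}}(\tau,u)=|\Omega_\theta|^2\int_{\mathbb{R}}\mathbf{x}\left(t+k\tfrac{\tau}{2}\right)\mathbf{x}^*\left(t-k\tfrac{\tau}{2}\right)e^{it(k\tau\cot\theta-u\csc\theta)}\,dt.$$ The short-time Fourier transform (STFT) of $\mathbf{x}$ with respect to a window $\mathbf{h}$ is $$\mathcal{V}_{\mathbf{h}}[\mathbf{x}](\tau,u)=\int_{\mathbb{R}}\mathbf{x}(y)\,\mathbf{h}^*(y-\tau)\,e^{-iuy}\,dy.$$ *)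

theory Defs
  imports "HOL-Analysis.Analysis"
begin

(* Members of L^2 are represented by functions rather than by classes modulo null sets:
   a statement about all x with L2_real x covers every representative of every class. *)
definition L2_real :: "(real \<Rightarrow> complex) \<Rightarrow> bool" where
  "L2_real x \<longleftrightarrow>
     x \<in> borel_measurable lebesgue \<and> integrable lebesgue (\<lambda>t. (cmod (x t))\<^sup>2)"

definition csc :: "real \<Rightarrow> real" where
  "csc \<theta> = 1 / sin \<theta>"

(* The square root is the principal branch. *)
definition Omega :: "real \<Rightarrow> complex" where
  "Omega \<theta> = csqrt ((1 - \<i> * of_real (cot \<theta>)) / of_real (2 * pi))"

definition NFrAF :: "real \<Rightarrow> real \<Rightarrow> (real \<Rightarrow> complex) \<Rightarrow> real \<Rightarrow> real \<Rightarrow> complex" where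
  "NFrAF \<theta> k x \<tau> u =
     of_real ((cmod (Omega \<theta>))\<^sup>2) *
     (LINT t|lebesgue. x (t + k * (\<tau> / 2)) * cnj (x (t - k * (\<tau> / 2))) *
        exp (\<i> * of_real (t * (k * \<tau> * cot \<theta> - u * csc \<theta>))))"

definition STFT :: "(real \<Rightarrow> complex) \<Rightarrow> (real \<Rightarrow> complex) \<Rightarrow> real \<Rightarrow> real \<Rightarrow> complex" where
  "STFT h x \<tau> u =
     (LINT y|lebesgue. x y * cnj (h (y - \<tau>)) * exp (- (\<i> * of_real (u * y))))"

end

theory Submission
  imports Defs
begin

text \<open>The shear \<open>u \<mapsto> u sin \<theta> + \<tau> cos \<theta>\<close> is the one that cancels the chirp term: since
  \<open>sin \<theta> \<noteq> 0\<close>, the frequency \<open>\<tau> cot \<theta> - (u sin \<theta> + \<tau> cos \<theta>) csc \<theta>\<close> equals \<open>-u\<close>.  What remains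
  is the classical symmetric ambiguity integral of \<open>x (t + \<tau>/2) (x (t - \<tau>/2))\<^sup>* exp (-i u t)\<close>,
  and the translation \<open>y = t + \<tau>/2\<close> turns it into the STFT integral, up to the phase
  \<open>exp (i u \<tau>/2)\<close>.\<close>

lemma sheared_chirp_frequency:
  fixes \<theta> \<tau> u :: real
  assumes "sin \<theta> \<noteq> 0"
  shows "\<tau> * cot \<theta> - (u * sin \<theta> + \<tau> * cos \<theta>) * csc \<theta> = - u"
  using assms by (simp add: cot_def csc_def field_simps)

text \<open>Both the translation of a Bochner integral and the extraction of a nonzero factor hold
  also when the integral takes its default value 0, so no integrability is needed.\<close>

lemma STFT_eq_symmetric_integral:
  "exp (\<i> * of_real (u * (\<tau> / 2))) * STFT h x \<tau> u =
     (LINT t|lebesgue. x (t + \<tau> / 2) * cnj (h (t - \<tau> / 2)) * exp (\<i> * of_real (t * - u)))"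
proof -
  have phase: "exp (\<i> * of_real (u * (\<tau> / 2))) * exp (- (\<i> * of_real (u * (\<tau> / 2 + t)))) =
      exp (\<i> * of_real (t * - u))" for t :: real
    by (simp add: exp_add [symmetric] algebra_simps)
  have "STFT h x \<tau> u = (LINT t|lebesgue. x (\<tau> / 2 + t) * cnj (h (\<tau> / 2 + t - \<tau>)) *
      exp (- (\<i> * of_real (u * (\<tau> / 2 + t)))))"
    unfolding STFT_def by (subst lebesgue_integral_real_affine [of 1 _ "\<tau> / 2"]) simp_all
  then have "exp (\<i> * of_real (u * (\<tau> / 2))) * STFT h x \<tau> u =
      (LINT t|lebesgue. exp (\<i> * of_real (u * (\<tau> / 2))) * (x (\<tau> / 2 + t) *
        cnj (h (\<tau> / 2 + t - \<tau>)) * exp (- (\<i> * of_real (u * (\<tau> / 2 + t))))))"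
    by (simp only: integral_mult_right_zero)
  also have "\<dots> = (LINT t|lebesgue. x (t + \<tau> / 2) * cnj (h (t - \<tau> / 2)) *
      exp (\<i> * of_real (t * - u)))"
  proof (intro Bochner_Integration.integral_cong refl)
    fix t :: real
    have args: "\<tau> / 2 + t = t + \<tau> / 2" "t + \<tau> / 2 - \<tau> = t - \<tau> / 2"
      by simp_all
    show "exp (\<i> * of_real (u * (\<tau> / 2))) * (x (\<tau> / 2 + t) * cnj (h (\<tau> / 2 + t - \<tau>)) *
        exp (- (\<i> * of_real (u * (\<tau> / 2 + t))))) =
      x (t + \<tau> / 2) * cnj (h (t - \<tau> / 2)) * exp (\<i> * of_real (t * - u))"
      unfolding phase [of t, symmetric] args by (simp only: mult_ac)
  qed
  finally show ?thesis .
qed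

theorem mainTheorem9:
  fixes x h :: "real \<Rightarrow> complex" and k \<theta> \<tau> u :: real
  assumes "L2_real x"
    and "k \<in> \<rat>" and "k > 0"
    and "\<forall>n::int. \<theta> \<noteq> of_int n * pi"
    and "h = x"
  shows "NFrAF \<theta> k x (\<tau> / k) (u * sin \<theta> + \<tau> * cos \<theta>) =
         of_real ((cmod (Omega \<theta>))\<^sup>2) * exp (\<i> * of_real (u * (\<tau> / 2))) * STFT h x \<tau> u"
proof -
  have "sin \<theta> \<noteq> 0"
    using assms(4) by (auto simp: sin_zero_iff_int2)
  note freq = sheared_chirp_frequency [OF this, of \<tau> u]
  have scale: "k * (\<tau> / k / 2) = \<tau> / 2" "k * (\<tau> / k) = \<tau>"
    using \<open>k > 0\<close> by simp_all
  show ?thesis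
    unfolding NFrAF_def scale freq mult.assoc [of "of_real _"] STFT_eq_symmetric_integral
    by (simp only: \<open>h = x\<close>)
qed

end
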